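(* Let $F:\mathbb{R}^n\to\mathcal{K}_{abcs}(\mathbb{R}^d)$ be a measurable, locally integrably bounded convex-set valued function. Then $F\in\mathcal{A}_1^{\mathcal{K}}$ if and only if the norm function $\rho(x,v)=p_{F(x)^\circ}(v)$ satisfies $\rho\in\mathcal{A}_1$. Moreover, $[F]_{\mathcal{A}_1^{\mathcal{K}}}\approx[\rho]_{\mathcal{A}_1}$ with implicit constants that depend only on $d$.
   Context: $\mathcal{K}_{abcs}(\mathbb{R}^d)$: closed, bounded, convex, symmetric ($-K=K$), absorbing (every $v\in\mathbb{R}^d$ lies in $tK$ for some $t>0$) subsets of $\mathbb{R}^d$. $F$ is measurable if $\{x:F(x)\cap U\neq\emptyset\}$ is measurable for each open $U\subset\mathbb{R}^d$; locally integrably bounded means $F(x)\subset k(x)\mathbf{B}$ a.e. for some nonnegative $k\in L^1_{loc}(\mathbb{R}^n)$, with $\mathbf{B}$ the open unit ball of $\mathbb{R}^d$. Polar set: $K^\circ=\{v:|\langle v,w\rangle|\le1\ \forall w\in K\}$; Minkowski functional: $p_K(v)=\inf\{r>0:v/r\in K\}$. Aumann integral: $\int_QF\,dy=\{\int_Qf\,dy:f\in L^1(Q,\mathbb{R}^d),\ f(y)\in F(y)\text{ a.e.}\}$. For a cube $Q$ (sides parallel to the axes), $A_QF(x)=\frac{1}{|Q|}\int_QF\,dy$ if $x\in Q$, $\{0\}$ otherwise; $MF(x)=\overline{\mathrm{conv}}(\bigcup_QA_QF(x))$ (closed convex hull over all cubes). $F\in\mathcal{A}_1^{\mathcal{K}}$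 means there is a constant $C$ with $MF(x)\subset CF(x)$ for a.e. $x$; $[F]_{\mathcal{A}_1^{\mathcal{K}}}$ is the infimum of such $C$. A norm function is $\rho:\mathbb{R}^n\times\mathbb{R}^d\to[0,\infty)$ with $\rho(\cdot,v)$ measurable for every $v$ and $\rho_x=\rho(x,\cdot)$ a norm for every $x$. For a norm $p$ on $\mathbb{R}^d$ the dual norm is $p^*(v)=\sup_{w\ne0}|\langle v,w\rangle|/p(w)$; $\rho^*(x,v)=(\rho_x)^*(v)$. Put $\langle\rho\rangle_{1,Q}(v)=\frac{1}{|Q|}\int_Q\rho_x(v)\,dx$ and $\langle\rho^*\rangle_{\infty,Q}(v)=\operatorname{ess\,sup}_{x\in Q}\rho_x^*(v)$. $\rho\in\mathcal{A}_1$ means there is a constant $C$ with $\langle\rho^*\rangle_{\infty,Q}(v)\le C\,(\langle\rho\rangle_{1,Q})^*(v)$ for every cube $Q$ and $v\in\mathbb{R}^d$; $[\rho]_{\mathcal{A}_1}$ is the infimum of such $C$. $A\approx B$ means $c_1A\le B\le c_2A$ with positive constants. *)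

theory Defs
  imports "HOL-Analysis.Analysis" "HOL-Probability.Essential_Supremum"
begin

text \<open>
  The domain \<open>\<real>\<^sup>n\<close> is the set of extensional functions \<open>{..<n} \<rightarrow>\<^sub>E UNIV\<close>, with \<open>n\<close> a term
  rather than a type: constants that must not depend on \<open>n\<close> can then be quantified before \<open>n\<close>.
  It carries the (completed) Lebesgue measure and the product topology.
  Only the values of functions on \<open>space (leb n)\<close> matter below.
\<close>

definition leb :: "nat \<Rightarrow> (nat \<Rightarrow> real) measure"
  where "leb n = completion (Pi\<^sub>M {..<n} (\<lambda>_. lborel))"

definition cubes :: "nat \<Rightarrow> (nat \<Rightarrow> real) set set"
  where "cubes n = {PiE {..<n} (\<lambda>i. {a i .. a i + r}) | a r. r > 0}"

definition loc_integrable :: "nat \<Rightarrow> ((nat \<Rightarrow> real) \<Rightarrow> real) \<Rightarrow> bool"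
  where "loc_integrable n k \<longleftrightarrow>
    (\<forall>K. compactin (product_topology (\<lambda>_. euclidean) {..<n}) K \<longrightarrow> set_integrable (leb n) K k)"

section \<open>Convex sets\<close>

definition absorbing :: "'v::euclidean_space set \<Rightarrow> bool"
  where "absorbing K \<longleftrightarrow> (\<forall>v. \<exists>t>0. v \<in> (\<lambda>w. t *\<^sub>R w) ` K)"

definition K_abcs :: "'v::euclidean_space set set"
  where "K_abcs = {K. closed K \<and> bounded K \<and> convex K \<and> uminus ` K = K \<and> absorbing K}"

definition polar_set :: "'v::euclidean_space set \<Rightarrow> 'v set"
  where "polar_set K = {v. \<forall>w\<in>K. \<bar>v \<bullet> w\<bar> \<le> 1}"

definition minkowski_functional :: "'v::euclidean_space set \<Rightarrow> 'v \<Rightarrow> real"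
  where "minkowski_functional K v = Inf {r. r > 0 \<and> v /\<^sub>R r \<in> K}"

section \<open>Convex-set valued functions\<close>

definition set_fun_measurable :: "nat \<Rightarrow> ((nat \<Rightarrow> real) \<Rightarrow> 'v::euclidean_space set) \<Rightarrow> bool"
  where "set_fun_measurable n F \<longleftrightarrow>
    (\<forall>U. open U \<longrightarrow> {x \<in> space (leb n). F x \<inter> U \<noteq> {}} \<in> sets (leb n))"

definition loc_integrably_bounded :: "nat \<Rightarrow> ((nat \<Rightarrow> real) \<Rightarrow> 'v::euclidean_space set) \<Rightarrow> bool"
  where "loc_integrably_bounded n F \<longleftrightarrow>
    (\<exists>k. (\<forall>x\<in>space (leb n). 0 \<le> k x) \<and> loc_integrable n k \<and>
         (AE x in leb n. F x \<subseteq> (\<lambda>w. k x *\<^sub>R w) ` ball 0 1))"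

definition aumann_integral ::
    "nat \<Rightarrow> (nat \<Rightarrow> real) set \<Rightarrow> ((nat \<Rightarrow> real) \<Rightarrow> 'v::euclidean_space set) \<Rightarrow> 'v set"
  where "aumann_integral n Q F =
    {set_lebesgue_integral (leb n) Q f | f.
       set_integrable (leb n) Q f \<and> (AE y in leb n. y \<in> Q \<longrightarrow> f y \<in> F y)}"

definition set_average ::
    "nat \<Rightarrow> (nat \<Rightarrow> real) set \<Rightarrow> ((nat \<Rightarrow> real) \<Rightarrow> 'v::euclidean_space set) \<Rightarrow> (nat \<Rightarrow> real) \<Rightarrow> 'v set"
  where "set_average n Q F x =
    (if x \<in> Q then (\<lambda>w. (1 / measure (leb n) Q) *\<^sub>R w) ` aumann_integral n Q F else {0})"

definition set_maximal ::
    "nat \<Rightarrow> ((nat \<Rightarrow> real) \<Rightarrow> 'v::euclidean_space set) \<Rightarrow> (nat \<Rightarrow> real) \<Rightarrow> 'v set"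
  where "set_maximal n F x = closure (convex hull (\<Union>Q\<in>cubes n. set_average n Q F x))"

definition A1K_bound :: "nat \<Rightarrow> ((nat \<Rightarrow> real) \<Rightarrow> 'v::euclidean_space set) \<Rightarrow> real \<Rightarrow> bool"
  where "A1K_bound n F C \<longleftrightarrow> (AE x in leb n. set_maximal n F x \<subseteq> (\<lambda>w. C *\<^sub>R w) ` F x)"

definition in_A1K :: "nat \<Rightarrow> ((nat \<Rightarrow> real) \<Rightarrow> 'v::euclidean_space set) \<Rightarrow> bool"
  where "in_A1K n F \<longleftrightarrow> (\<exists>C>0. A1K_bound n F C)"

text \<open>Both \<open>A\<^sub>1\<close> constants are \<open>\<infinity>\<close> when no admissible \<open>C\<close> exists (infimum of the empty set). The
  restriction \<open>C > 0\<close> matters: for symmetric values, \<open>C\<close> and \<open>- C\<close> give the same inclusion.\<close>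

definition A1K_const :: "nat \<Rightarrow> ((nat \<Rightarrow> real) \<Rightarrow> 'v::euclidean_space set) \<Rightarrow> ennreal"
  where "A1K_const n F = (INF C\<in>{C. C > 0 \<and> A1K_bound n F C}. ennreal C)"

section \<open>Norm functions\<close>

definition is_norm :: "('v::euclidean_space \<Rightarrow> real) \<Rightarrow> bool"
  where "is_norm p \<longleftrightarrow>
    (\<forall>v. 0 \<le> p v) \<and> (\<forall>v. p v = 0 \<longleftrightarrow> v = 0) \<and>
    (\<forall>c v. p (c *\<^sub>R v) = \<bar>c\<bar> * p v) \<and> (\<forall>v w. p (v + w) \<le> p v + p w)"

definition norm_function :: "nat \<Rightarrow> ((nat \<Rightarrow> real) \<Rightarrow> 'v::euclidean_space \<Rightarrow> real) \<Rightarrow> bool"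
  where "norm_function n \<rho> \<longleftrightarrow>
    (\<forall>v. (\<lambda>x. \<rho> x v) \<in> borel_measurable (leb n)) \<and> (\<forall>x\<in>space (leb n). is_norm (\<rho> x))"

text \<open>Averages and essential suprema of a norm function may be infinite, so the dual norm and the
  averages take values in \<^typ>\<open>ennreal\<close>; for an actual norm \<open>p\<close> the value of
  \<open>dual_norm (\<lambda>w. ennreal (p w))\<close> is the usual finite dual norm.\<close>

definition dual_norm :: "('v::euclidean_space \<Rightarrow> ennreal) \<Rightarrow> 'v \<Rightarrow> ennreal"
  where "dual_norm p v = (SUP w\<in>- {0}. ennreal \<bar>v \<bullet> w\<bar> / p w)"

definition dual_norm_function ::
    "((nat \<Rightarrow> real) \<Rightarrow> 'v::euclidean_space \<Rightarrow> real) \<Rightarrow> (nat \<Rightarrow> real) \<Rightarrow> 'v \<Rightarrow> ennreal"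
  where "dual_norm_function \<rho> x = dual_norm (\<lambda>w. ennreal (\<rho> x w))"

definition norm_average ::
    "nat \<Rightarrow> (nat \<Rightarrow> real) set \<Rightarrow> ((nat \<Rightarrow> real) \<Rightarrow> 'v::euclidean_space \<Rightarrow> real) \<Rightarrow> 'v \<Rightarrow> ennreal"
  where "norm_average n Q \<rho> v =
    (\<integral>\<^sup>+x\<in>Q. ennreal (\<rho> x v) \<partial>leb n) / emeasure (leb n) Q"

definition dual_esssup ::
    "nat \<Rightarrow> (nat \<Rightarrow> real) set \<Rightarrow> ((nat \<Rightarrow> real) \<Rightarrow> 'v::euclidean_space \<Rightarrow> real) \<Rightarrow> 'v \<Rightarrow> ennreal"
  where "dual_esssup n Q \<rho> v = esssup (restrict_space (leb n) Q) (\<lambda>x. dual_norm_function \<rho> x v)"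

definition A1_bound :: "nat \<Rightarrow> ((nat \<Rightarrow> real) \<Rightarrow> 'v::euclidean_space \<Rightarrow> real) \<Rightarrow> real \<Rightarrow> bool"
  where "A1_bound n \<rho> C \<longleftrightarrow>
    (\<forall>Q\<in>cubes n. \<forall>v. dual_esssup n Q \<rho> v \<le> ennreal C * dual_norm (norm_average n Q \<rho>) v)"

definition in_A1 :: "nat \<Rightarrow> ((nat \<Rightarrow> real) \<Rightarrow> 'v::euclidean_space \<Rightarrow> real) \<Rightarrow> bool"
  where "in_A1 n \<rho> \<longleftrightarrow> (\<exists>C>0. A1_bound n \<rho> C)"

definition A1_const :: "nat \<Rightarrow> ((nat \<Rightarrow> real) \<Rightarrow> 'v::euclidean_space \<Rightarrow> real) \<Rightarrow> ennreal"
  where "A1_const n \<rho> = (INF C\<in>{C. C > 0 \<and> A1_bound n \<rho> C}. ennreal C)"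

end

theory Submission
  imports Defs
begin

text \<open>
  For \<open>K\<close> in \<open>K_abcs\<close> the Minkowski functional of the polar set is the support function of \<open>K\<close>, and
  \<open>K\<close> is the unit ball of its dual norm. Write \<open>N\<^sub>Q\<close> for the average of \<open>\<rho>\<close> over \<open>Q\<close>. Both \<open>A\<^sub>1\<close>
  conditions say that \<open>N\<^sub>Q \<le> C \<rho>\<^sub>x\<close> for all cubes \<open>Q\<close> and almost every \<open>x \<in> Q\<close>, so they hold for the
  same \<open>C\<close>. If the averages of \<open>F\<close> lie in \<open>C F(x)\<close>, measurable selections that almost maximise
  \<open>f(y) \<bullet> w\<close> give \<open>N\<^sub>Q \<le> C \<rho>\<^sub>x\<close>, and duality reverses the inequality. Conversely, the averages of \<open>F\<close>
  lie in the unit ball of the dual of \<open>N\<^sub>Q\<close>, which the \<open>A\<^sub>1\<close> condition puts inside \<open>C F(x)\<close>. One null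
  set serves all cubes and vectors: a countable dense set of vectors is dense in each dual ball,
  and every cube is the limit of rational cubes containing it.
\<close>

section \<open>Norms and their dual balls\<close>

text \<open>Unit ball of the dual norm, written without quotients so that it stays within the reals;
  for a norm the condition at \<open>w = 0\<close> is void.\<close>

definition dual_ball :: "('v::euclidean_space \<Rightarrow> real) \<Rightarrow> 'v set"
  where "dual_ball p = {v. \<forall>w. \<bar>v \<bullet> w\<bar> \<le> p w}"

lemma is_norm_pos: "is_norm p \<Longrightarrow> w \<noteq> 0 \<Longrightarrow> 0 < p w"
  by (simp add: is_norm_def less_le)

text \<open>Subadditivity and homogeneity make \<open>p\<close> convex, and a finite convex function
  on a Euclidean space is continuous.\<close>

lemma is_norm_imp_continuous:
  fixes p :: "'v::euclidean_space \<Rightarrow> real"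
  assumes p: "is_norm p"
  shows "continuous_on UNIV p"
proof (rule convex_on_continuous[OF open_UNIV], rule convex_onI)
  fix t :: real and x y :: 'v
  assume "0 < t" "t < 1"
  have "p ((1 - t) *\<^sub>R x + t *\<^sub>R y) \<le> p ((1 - t) *\<^sub>R x) + p (t *\<^sub>R y)"
    using p unfolding is_norm_def by blast
  also have "\<dots> = (1 - t) * p x + t * p y"
    using \<open>0 < t\<close> \<open>t < 1\<close> p by (simp add: is_norm_def)
  finally show "p ((1 - t) *\<^sub>R x + t *\<^sub>R y) \<le> (1 - t) * p x + t * p y" .
qed simp

text \<open>The continuous function \<open>p\<close> attains a positive minimum on the compact unit
  sphere; homogeneity carries the bound to all vectors.\<close>

lemma is_norm_imp_lower_bound:
  fixes p :: "'v::euclidean_space \<Rightarrow> real"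
  assumes p: "is_norm p"
  obtains m where "m > 0" "\<And>w. m * norm w \<le> p w"
proof -
  have "continuous_on (sphere 0 1) p"
    using is_norm_imp_continuous[OF p] by (rule continuous_on_subset) simp
  moreover have "sphere (0::'v) 1 \<noteq> {}"
    by simp
  ultimately obtain u where u: "u \<in> sphere 0 1" "\<And>w. w \<in> sphere 0 1 \<Longrightarrow> p u \<le> p w"
    using continuous_attains_inf[of "sphere 0 1" p] compact_sphere by blast
  have "p u > 0"
    using u(1) by (intro is_norm_pos[OF p]) auto
  moreover have "p u * norm w \<le> p w" for w
  proof (cases "w = 0")
    case True
    then show ?thesis using p by (simp add: is_norm_def)
  next
    case False
    then have "p u \<le> p (w /\<^sub>R norm w)"
      by (intro u(2)) simp
    also have "\<dots> = p w / norm w"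
      using p by (simp add: is_norm_def field_simps)
    finally show ?thesis
      using False by (simp add: field_simps)
  qed
  ultimately show ?thesis by (rule that)
qed

lemma convex_dual_ball: "convex (dual_ball p)"
proof (rule convexI)
  fix x y :: 'a and u v :: real
  assume xy: "x \<in> dual_ball p" "y \<in> dual_ball p" and uv: "0 \<le> u" "0 \<le> v" "u + v = 1"
  have "\<bar>(u *\<^sub>R x + v *\<^sub>R y) \<bullet> w\<bar> \<le> p w" for w
  proof -
    have "\<bar>(u *\<^sub>R x + v *\<^sub>R y) \<bullet> w\<bar> \<le> u * \<bar>x \<bullet> w\<bar> + v * \<bar>y \<bullet> w\<bar>"
      using abs_triangle_ineq[of "u * (x \<bullet> w)" "v * (y \<bullet> w)"] uv
      by (simp add: inner_add_left abs_mult)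
    also have "\<dots> \<le> u * p w + v * p w"
      using xy uv by (intro add_mono mult_left_mono) (auto simp: dual_ball_def)
    finally show ?thesis
      using uv by (simp flip: distrib_right)
  qed
  then show "u *\<^sub>R x + v *\<^sub>R y \<in> dual_ball p"
    by (simp add: dual_ball_def)
qed

text \<open>By the lower bound on \<open>p\<close> and Cauchy-Schwarz the dual ball contains a ball
  about 0. A convex set with interior points lies in the closure of its interior, and
  \<open>D\<close> is dense in that open set.\<close>

lemma dual_ball_subset_closure_dense:
  fixes p :: "'v::euclidean_space \<Rightarrow> real"
  assumes p: "is_norm p" and D: "\<And>X. open X \<Longrightarrow> X \<noteq> {} \<Longrightarrow> \<exists>d\<in>D. d \<in> X"
  shows "dual_ball p \<subseteq> closure (dual_ball p \<inter> D)"
proof -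
  obtain m where m: "m > 0" "\<And>w. m * norm w \<le> p w"
    using is_norm_imp_lower_bound[OF p] by blast
  have "ball 0 m \<subseteq> dual_ball p"
  proof
    fix v :: 'v
    assume "v \<in> ball 0 m"
    then have "\<bar>v \<bullet> w\<bar> \<le> p w" for w
      using Cauchy_Schwarz_ineq2[of v w] m(2)[of w] mult_right_mono[of "norm v" m "norm w"]
      by simp
    then show "v \<in> dual_ball p" by (simp add: dual_ball_def)
  qed
  then have "ball 0 m \<subseteq> interior (dual_ball p)"
    by (simp add: interior_maximal)
  moreover have "0 \<in> ball (0::'v) m"
    using m(1) by simp
  ultimately have "interior (dual_ball p) \<noteq> {}"
    by blast
  then have "closure (interior (dual_ball p)) = closure (dual_ball p)"
    by (rule convex_closure_interior[OF convex_dual_ball])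
  moreover have "interior (dual_ball p) \<subseteq> closure (dual_ball p \<inter> D)"
  proof
    fix x assume x: "x \<in> interior (dual_ball p)"
    show "x \<in> closure (dual_ball p \<inter> D)"
      unfolding closure_iff_nhds_not_empty
    proof (intro allI impI)
      fix A V assume "V \<subseteq> A" "open V" "x \<in> V"
      then have "open (V \<inter> interior (dual_ball p))" "V \<inter> interior (dual_ball p) \<noteq> {}"
        using x by auto
      from D[OF this] show "(dual_ball p \<inter> D) \<inter> A \<noteq> {}"
        using interior_subset[of "dual_ball p"] \<open>V \<subseteq> A\<close> by blast
    qed
  qed
  then have "closure (interior (dual_ball p)) \<subseteq> closure (dual_ball p \<inter> D)"
    by (simp add: closure_minimal)
  ultimately show ?thesis
    using closure_subset[of "dual_ball p"] by simp
qed

text \<open>Passes from \<open>ennreal\<close> quotients to real inequalities; the vector 0, left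
  out of the supremum, adds nothing because \<open>p 0 = 0\<close>.\<close>

lemma dual_norm_le_iff:
  assumes p: "is_norm p" and c: "0 \<le> c"
  shows "dual_norm (\<lambda>w. ennreal (p w)) v \<le> ennreal c \<longleftrightarrow> (\<forall>w. \<bar>v \<bullet> w\<bar> \<le> c * p w)"
proof -
  have p0: "p 0 = 0" and pos: "w \<noteq> 0 \<Longrightarrow> p w > 0" for w
    using p is_norm_pos[OF p] by (simp_all add: is_norm_def)
  have "ennreal \<bar>v \<bullet> w\<bar> / ennreal (p w) \<le> ennreal c \<longleftrightarrow> \<bar>v \<bullet> w\<bar> \<le> c * p w" if "w \<noteq> 0" for w
    using pos[OF that] c by (simp add: divide_ennreal pos_divide_le_eq)
  then show ?thesis
    unfolding dual_norm_def by (auto simp: SUP_le_iff p0)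
qed

section \<open>Support functions\<close>

lemma K_abcs_zero:
  assumes "K \<in> K_abcs"
  shows "0 \<in> K"
proof -
  obtain t w where "t > 0" "w \<in> K" "0 = t *\<^sub>R w"
    using assms unfolding K_abcs_def absorbing_def by blast
  then show ?thesis by simp
qed

lemma K_abcs_uminus: "K \<in> K_abcs \<Longrightarrow> w \<in> K \<Longrightarrow> - w \<in> K"
  unfolding K_abcs_def by blast

text \<open>\<open>v / r\<close> lies in the polar set exactly if \<open>r\<close> bounds
  \<open>\<bar>v \<bullet> w\<bar>\<close> on \<open>K\<close>. The infimum of these bounds is the
  support function of the symmetric set \<open>K\<close>; the next two lemmas are its defining
  inequalities.\<close>

lemma minkowski_functional_polar:
  "minkowski_functional (polar_set K) v = Inf {r. r > 0 \<and> (\<forall>w\<in>K. \<bar>v \<bullet> w\<bar> \<le> r)}"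
proof -
  have "r > 0 \<and> v /\<^sub>R r \<in> polar_set K \<longleftrightarrow> r > 0 \<and> (\<forall>w\<in>K. \<bar>v \<bullet> w\<bar> \<le> r)" for r
    by (auto simp: polar_set_def abs_mult field_simps)
  then show ?thesis by (simp add: minkowski_functional_def)
qed

lemma minkowski_functional_polar_upper:
  assumes K: "K \<in> K_abcs" and w: "w \<in> K"
  shows "\<bar>v \<bullet> w\<bar> \<le> minkowski_functional (polar_set K) v"
  unfolding minkowski_functional_polar
proof (rule cInf_greatest)
  \<comment> \<open>Boundedness of \<open>K\<close> is what makes the set of admissible
    \<open>r\<close> nonempty; the summand 1 below keeps the bound positive for
    \<open>v = 0\<close>.\<close>
  obtain B where B: "B > 0" "\<And>x. x \<in> K \<Longrightarrow> norm x \<le> B"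
    using K bounded_pos[of K] by (auto simp: K_abcs_def)
  have "\<bar>v \<bullet> x\<bar> \<le> norm v * B + 1" if "x \<in> K" for x
    using Cauchy_Schwarz_ineq2[of v x] mult_left_mono[OF B(2)[OF that], of "norm v"] by simp
  moreover have "norm v * B + 1 > 0"
    using B(1) by (simp add: add_nonneg_pos)
  ultimately show "{r. r > 0 \<and> (\<forall>w\<in>K. \<bar>v \<bullet> w\<bar> \<le> r)} \<noteq> {}" by blast
qed (use w in auto)

lemma minkowski_functional_polar_least:
  assumes "c \<ge> 0" "\<And>w. w \<in> K \<Longrightarrow> \<bar>v \<bullet> w\<bar> \<le> c"
  shows "minkowski_functional (polar_set K) v \<le> c"
proof (rule field_le_epsilon)
  \<comment> \<open>Only positive \<open>r\<close> enter the infimum while \<open>c\<close> may be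
    0, so \<open>c + e\<close> is used instead.\<close>
  fix e :: real assume "e > 0"
  have "bdd_below {r. r > 0 \<and> (\<forall>w\<in>K. \<bar>v \<bullet> w\<bar> \<le> r)}"
    by (rule bdd_belowI[of _ 0]) auto
  then show "minkowski_functional (polar_set K) v \<le> c + e"
    unfolding minkowski_functional_polar
    using assms \<open>e > 0\<close> by (intro cInf_lower) force+
qed

text \<open>Symmetry of \<open>K\<close> removes the absolute value, and \<open>0 \<in> K\<close>
  forces \<open>c \<ge> 0\<close>. The one-sided form fits half-spaces, as needed for separation,
  measurability and near maximisers.\<close>

lemma minkowski_functional_polar_le_iff:
  assumes K: "K \<in> K_abcs"
  shows "minkowski_functional (polar_set K) v \<le> c \<longleftrightarrow> (\<forall>w\<in>K. v \<bullet> w \<le> c)"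
proof
  assume *: "\<forall>w\<in>K. v \<bullet> w \<le> c"
  then have "c \<ge> 0"
    using K_abcs_zero[OF K] by force
  moreover have "\<bar>v \<bullet> w\<bar> \<le> c" if "w \<in> K" for w
    using * that K_abcs_uminus[OF K that] by (force simp: abs_le_iff)
  ultimately show "minkowski_functional (polar_set K) v \<le> c"
    by (rule minkowski_functional_polar_least)
qed (use minkowski_functional_polar_upper[OF K] abs_le_D1 in \<open>blast intro: order_trans\<close>)

text \<open>Definiteness comes from absorption: \<open>v\<close> is a positive multiple of some
  \<open>w \<in> K\<close>, and the value 0 at \<open>v\<close> forces
  \<open>w \<bullet> w \<le> 0\<close>. Homogeneity is an inequality applied to a scalar and to its
  inverse.\<close>

lemma is_norm_minkowski_functional_polar:
  assumes K: "K \<in> K_abcs"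
  shows "is_norm (minkowski_functional (polar_set K))"
proof -
  let ?p = "minkowski_functional (polar_set K)"
  note upper = minkowski_functional_polar_upper[OF K]
  have nonneg: "0 \<le> ?p v" for v
    using upper[OF K_abcs_zero[OF K], of v] by simp
  have zero: "?p 0 = 0"
    using nonneg[of 0] minkowski_functional_polar_least[of 0 K 0] by simp
  have definite: "v = 0" if "?p v = 0" for v
  proof -
    obtain t w where "t > 0" "w \<in> K" "v = t *\<^sub>R w"
      using K unfolding K_abcs_def absorbing_def by blast
    moreover have "w \<bullet> w \<le> 0"
      using upper[OF \<open>w \<in> K\<close>, of v] that \<open>t > 0\<close> \<open>v = t *\<^sub>R w\<close>
      by (simp add: abs_mult mult_le_0_iff)
    ultimately show ?thesis
      using inner_eq_zero_iff[of w] inner_ge_zero[of w] by simp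
  qed
  have scale_le: "?p (c *\<^sub>R v) \<le> \<bar>c\<bar> * ?p v" for c v
    by (rule minkowski_functional_polar_least)
      (simp_all add: nonneg abs_mult mult_left_mono upper)
  have "?p (c *\<^sub>R v) = \<bar>c\<bar> * ?p v" for c v
  proof (cases "c = 0")
    case False
    then show ?thesis
      using scale_le[of c v] scale_le[of "inverse c" "c *\<^sub>R v"]
      by (simp add: field_simps)
  qed (simp add: zero)
  moreover have "?p (v + w) \<le> ?p v + ?p w" for v w
  proof (rule minkowski_functional_polar_least)
    fix u assume "u \<in> K"
    then show "\<bar>(v + w) \<bullet> u\<bar> \<le> ?p v + ?p w"
      using upper[of u v] upper[of u w] by (simp add: inner_add_left)
  qed (simp add: nonneg)
  ultimately show ?thesis
    using nonneg zero definite unfolding is_norm_def by blast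
qed

text \<open>A bipolar theorem: a point outside the closed convex set \<open>K\<close> is strictly
  separated from it by a hyperplane.\<close>

lemma dual_ball_minkowski_functional_polar:
  assumes K: "K \<in> K_abcs"
  shows "dual_ball (minkowski_functional (polar_set K)) = K"
proof
  show "K \<subseteq> dual_ball (minkowski_functional (polar_set K))"
    using minkowski_functional_polar_upper[OF K] by (auto simp: dual_ball_def inner_commute)
  show "dual_ball (minkowski_functional (polar_set K)) \<subseteq> K"
  proof (rule ccontr)
    assume "\<not> ?thesis"
    then obtain z where z: "z \<in> dual_ball (minkowski_functional (polar_set K))" "z \<notin> K"
      by blast
    then obtain a b where ab: "a \<bullet> z < b" "\<And>x. x \<in> K \<Longrightarrow> a \<bullet> x > b"
      using separating_hyperplane_closed_point[of K z] K by (auto simp: K_abcs_def)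
    \<comment> \<open>Since \<open>K\<close> lies where \<open>a \<bullet> x > b\<close>, the
      support function at \<open>- a\<close> is at most \<open>- b\<close>, while \<open>z\<close>
      pairs with \<open>- a\<close> to more than \<open>- b\<close>.\<close>
    have "minkowski_functional (polar_set K) (- a) \<le> - b"
      using minkowski_functional_polar_le_iff[OF K] ab(2) by (simp add: less_imp_le)
    moreover have "\<bar>z \<bullet> (- a)\<bar> \<le> minkowski_functional (polar_set K) (- a)"
      using z(1) unfolding dual_ball_def by blast
    ultimately show False
      using ab(1) by (simp add: inner_commute)
  qed
qed

lemma mem_scaleR_image_iff:
  assumes K: "K \<in> K_abcs" and C: "C > 0"
  shows "v \<in> (\<lambda>w. C *\<^sub>R w) ` K \<longleftrightarrow> (\<forall>w. \<bar>v \<bullet> w\<bar> \<le> C * minkowski_functional (polar_set K) w)"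
proof -
  have "v \<in> (\<lambda>w. C *\<^sub>R w) ` K \<longleftrightarrow> v /\<^sub>R C \<in> dual_ball (minkowski_functional (polar_set K))"
    unfolding dual_ball_minkowski_functional_polar[OF K]
    using C by (auto simp: image_iff intro!: bexI[of _ "v /\<^sub>R C"])
  then show ?thesis
    using C by (simp add: dual_ball_def abs_mult field_simps)
qed

section \<open>Lebesgue measure on cubes\<close>

interpretation lborel_product: product_sigma_finite "\<lambda>_::nat. lborel :: real measure"
  by standard

lemma cube_sets: "Q \<in> cubes n \<Longrightarrow> Q \<in> sets (leb n)"
  unfolding cubes_def leb_def by (auto intro!: sets_completionI_sets sets_PiM_I_finite)

lemma emeasure_cube:
  assumes "r > 0"
  shows "emeasure (leb n) (PiE {..<n} (\<lambda>i. {a i .. a i + r})) = ennreal (r ^ n)"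
proof -
  have "emeasure (leb n) (PiE {..<n} (\<lambda>i. {a i .. a i + r}))
      = emeasure (Pi\<^sub>M {..<n} (\<lambda>_. lborel)) (PiE {..<n} (\<lambda>i. {a i .. a i + r}))"
    unfolding leb_def by (simp add: sets_PiM_I_finite)
  also have "\<dots> = (\<Prod>i\<in>{..<n}. emeasure lborel {a i .. a i + r})"
    by (intro lborel_product.emeasure_PiM) auto
  also have "\<dots> = ennreal (r ^ n)"
    using assms by (simp add: ennreal_power)
  finally show ?thesis .
qed

lemma measure_cube:
  assumes "r > 0"
  shows "measure (leb n) (PiE {..<n} (\<lambda>i. {a i .. a i + r})) = r ^ n"
  using emeasure_cube[OF assms] assms by (simp add: measure_def)

lemma measure_cube_pos: "Q \<in> cubes n \<Longrightarrow> measure (leb n) Q > 0"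
  unfolding cubes_def by (auto simp: measure_cube)

lemma emeasure_eq_measure_cube: "Q \<in> cubes n \<Longrightarrow> emeasure (leb n) Q = ennreal (measure (leb n) Q)"
  unfolding cubes_def by (auto simp: measure_cube emeasure_cube)

lemma compactin_cube:
  "Q \<in> cubes n \<Longrightarrow> compactin (product_topology (\<lambda>_. euclidean) {..<n}) Q"
  unfolding cubes_def by (auto simp: compactin_PiE)

text \<open>\<open>R\<close> consists of the cubes with rational corner and side. Every cube is
  covered by members of \<open>R\<close> of almost the same measure, so countably many null sets
  will suffice.\<close>

lemma rational_cubes:
  obtains R where "countable R" "R \<subseteq> cubes n"
    "\<And>Q t. Q \<in> cubes n \<Longrightarrow> t > measure (leb n) Q \<Longrightarrow> \<exists>Q'\<in>R. Q \<subseteq> Q' \<and> measure (leb n) Q' < t"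
proof
  define c where "c = (\<lambda>(a :: nat \<Rightarrow> real, r :: real). PiE {..<n} (\<lambda>i. {a i .. a i + r}))"
  define R where "R = c ` (PiE {..<n} (\<lambda>_. \<rat>) \<times> {r\<in>\<rat>. r > 0})"
  show "countable R"
    unfolding R_def
    by (intro countable_image countable_SIGMA countable_PiE countable_Collect) (auto simp: countable_rat)
  show "R \<subseteq> cubes n"
    unfolding R_def c_def cubes_def by auto
  fix Q t assume "Q \<in> cubes n" and t: "t > measure (leb n) Q"
  then obtain a r where r: "r > 0" and Q: "Q = PiE {..<n} (\<lambda>i. {a i .. a i + r})"
    by (auto simp: cubes_def)
  \<comment> \<open>Continuity of the volume in the side length leaves room for a rational side
    \<open>r'\<close> slightly above \<open>r\<close>.\<close>
  have "((\<lambda>s. s ^ n) \<longlongrightarrow> r ^ n) (at_right r)"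
    by (intro tendsto_intros)
  moreover have "t > r ^ n"
    using t r by (simp add: Q measure_cube)
  ultimately have "eventually (\<lambda>s. s ^ n < t) (at_right r)"
    by (rule order_tendstoD)
  then obtain b where b: "b > r" "\<And>s. r < s \<Longrightarrow> s < b \<Longrightarrow> s ^ n < t"
    by (auto simp: eventually_at_right_field)
  obtain r' where r': "r' \<in> \<rat>" "r < r'" "r' < b"
    using Rats_dense_in_real[OF b(1)] by blast
  \<comment> \<open>Moving the corner left by less than \<open>r' - r\<close> keeps the right end
    \<open>q i + r'\<close> beyond \<open>a i + r\<close>.\<close>
  have "\<exists>q. q \<in> \<rat> \<and> a i - (r' - r) < q \<and> q < a i" for i
    using Rats_dense_in_real[of "a i - (r' - r)" "a i"] r' by auto
  then obtain q where q: "\<And>i. q i \<in> \<rat>" "\<And>i. a i - (r' - r) < q i" "\<And>i. q i < a i"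
    by metis
  \<comment> \<open>The corners indexing \<open>R\<close> are extensional functions, for
    countability; restricting \<open>q\<close> does not change the cube.\<close>
  have "PiE {..<n} (\<lambda>i. {q i .. q i + r'}) = c (restrict q {..<n}, r')"
    unfolding c_def by (auto intro!: PiE_cong)
  then have "PiE {..<n} (\<lambda>i. {q i .. q i + r'}) \<in> R"
    unfolding R_def using q(1) r' r by auto
  moreover have "Q \<subseteq> PiE {..<n} (\<lambda>i. {q i .. q i + r'})"
    unfolding Q
  proof (rule PiE_mono)
    fix i
    show "{a i .. a i + r} \<subseteq> {q i .. q i + r'}"
      using q(2)[of i] q(3)[of i] by auto
  qed
  moreover have "measure (leb n) (PiE {..<n} (\<lambda>i. {q i .. q i + r'})) < t"
    using r r' b(2)[of r'] by (simp add: measure_cube)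
  ultimately show "\<exists>Q'\<in>R. Q \<subseteq> Q' \<and> measure (leb n) Q' < t"
    by blast
qed

section \<open>Averages of convex-set valued functions\<close>

text \<open>An enumeration rather than a countable set, so that selections can take the least
  suitable index.\<close>

lemma countable_dense_sequence:
  obtains d :: "nat \<Rightarrow> 'v::euclidean_space"
  where "\<And>X. open X \<Longrightarrow> X \<noteq> {} \<Longrightarrow> \<exists>e\<in>range d. e \<in> X"
proof -
  obtain D :: "'v set" where D: "countable D" "\<And>X. open X \<Longrightarrow> X \<noteq> {} \<Longrightarrow> \<exists>d\<in>D. d \<in> X"
    using countable_dense_exists by blast
  then have "D \<noteq> {}"
    using D(2)[of UNIV] by auto
  then have "range (from_nat_into D) = D"
    using D(1) by (rule range_from_nat_into)
  then show ?thesis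
    using D(2) that[of "from_nat_into D"] by simp
qed

locale abcs_map =
  fixes n :: nat and F :: "(nat \<Rightarrow> real) \<Rightarrow> 'v::euclidean_space set"
  assumes F_abcs: "x \<in> space (leb n) \<Longrightarrow> F x \<in> K_abcs"
    and F_measurable: "set_fun_measurable n F"
    and F_bounded: "loc_integrably_bounded n F"
begin

abbreviation \<rho> :: "(nat \<Rightarrow> real) \<Rightarrow> 'v \<Rightarrow> real"
  where "\<rho> \<equiv> (\<lambda>x v. minkowski_functional (polar_set (F x)) v)"

text \<open>Real-valued counterpart of \<open>norm_average\<close>; \<open>norm_average_rho\<close>
  shows that they agree on cubes, where \<open>\<rho>\<close> is integrable.\<close>

definition avg :: "(nat \<Rightarrow> real) set \<Rightarrow> 'v \<Rightarrow> real"
  where "avg Q v = set_lebesgue_integral (leb n) Q (\<lambda>x. \<rho> x v) / measure (leb n) Q"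

section \<open>Pointwise norms and measurability\<close>

lemma is_norm_rho: "x \<in> space (leb n) \<Longrightarrow> is_norm (\<rho> x)"
  by (rule is_norm_minkowski_functional_polar[OF F_abcs])

lemma rho_nonneg: "x \<in> space (leb n) \<Longrightarrow> 0 \<le> \<rho> x v"
  using is_norm_rho by (auto simp: is_norm_def)

lemma dual_ball_rho: "x \<in> space (leb n) \<Longrightarrow> dual_ball (\<rho> x) = F x"
  by (rule dual_ball_minkowski_functional_polar[OF F_abcs])

lemma mem_F_iff: "x \<in> space (leb n) \<Longrightarrow> v \<in> F x \<longleftrightarrow> (\<forall>w. \<bar>v \<bullet> w\<bar> \<le> \<rho> x w)"
  using dual_ball_rho unfolding dual_ball_def by blast

text \<open>\<open>\<rho> x v > c\<close> holds exactly if \<open>F x\<close> meets an open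
  half-space, so measurability of \<open>F\<close> applies.\<close>

lemma measurable_rho [measurable]: "(\<lambda>x. \<rho> x v) \<in> borel_measurable (leb n)"
proof (rule borel_measurableI_le)
  fix c
  have "\<rho> x v \<le> c \<longleftrightarrow> F x \<inter> {w. v \<bullet> w > c} = {}" if "x \<in> space (leb n)" for x
    unfolding minkowski_functional_polar_le_iff[OF F_abcs[OF that]] by (auto simp flip: not_le)
  then have "{x \<in> space (leb n). \<rho> x v \<le> c} = space (leb n)
      - {x \<in> space (leb n). F x \<inter> {w. v \<bullet> w > c} \<noteq> {}}"
    by auto
  also have "\<dots> \<in> sets (leb n)"
    using F_measurable open_halfspace_gt[of c v] unfolding set_fun_measurable_def by blast
  finally show "{x \<in> space (leb n). \<rho> x v \<le> c} \<in> sets (leb n)" .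
qed

lemma norm_function_rho: "norm_function n \<rho>"
  unfolding norm_function_def using measurable_rho is_norm_rho by blast

text \<open>Both sides are continuous in \<open>w\<close>, so a violation at one \<open>w\<close>
  persists on an open set and is seen by a dense sequence. This leaves countably many
  conditions.\<close>

lemma sets_mem_scaled:
  "{x \<in> space (leb n). \<forall>w. \<bar>v \<bullet> w\<bar> \<le> c * \<rho> x w} \<in> sets (leb n)"
proof -
  obtain d :: "nat \<Rightarrow> 'v" where d: "\<And>X. open X \<Longrightarrow> X \<noteq> {} \<Longrightarrow> \<exists>e\<in>range d. e \<in> X"
    using countable_dense_sequence by blast
  have "(\<forall>w. \<bar>v \<bullet> w\<bar> \<le> c * \<rho> x w) \<longleftrightarrow> (\<forall>i. \<bar>v \<bullet> d i\<bar> \<le> c * \<rho> x (d i))"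
    if x: "x \<in> space (leb n)" for x
  proof (intro iffI allI)
    fix w
    assume *: "\<forall>i. \<bar>v \<bullet> d i\<bar> \<le> c * \<rho> x (d i)"
    show "\<bar>v \<bullet> w\<bar> \<le> c * \<rho> x w"
    proof (rule ccontr)
      assume "\<not> ?thesis"
      then have "w \<in> {w. c * \<rho> x w < \<bar>v \<bullet> w\<bar>}" by simp
      moreover have "open {w. c * \<rho> x w < \<bar>v \<bullet> w\<bar>}"
        by (intro open_Collect_less continuous_intros is_norm_imp_continuous is_norm_rho x)
      ultimately show False
        using d * by (fastforce simp: not_less[symmetric])
    qed
  qed simp
  then have "{x \<in> space (leb n). \<forall>w. \<bar>v \<bullet> w\<bar> \<le> c * \<rho> x w}
      = {x \<in> space (leb n). \<forall>i. \<bar>v \<bullet> d i\<bar> \<le> c * \<rho> x (d i)}"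
    by blast
  also have "\<dots> \<in> sets (leb n)"
    by measurable
  finally show ?thesis .
qed

text \<open>Sublevel sets at finite levels are the sets of \<open>sets_mem_scaled\<close>; at level
  infinity nothing is required.\<close>

lemma measurable_dual_norm_function [measurable]:
  "(\<lambda>x. dual_norm_function \<rho> x v) \<in> borel_measurable (leb n)"
proof (rule borel_measurableI_le)
  fix c :: ennreal
  show "{x \<in> space (leb n). dual_norm_function \<rho> x v \<le> c} \<in> sets (leb n)"
  proof (cases c)
    case (real r)
    have "{x \<in> space (leb n). dual_norm_function \<rho> x v \<le> c}
        = {x \<in> space (leb n). \<forall>w. \<bar>v \<bullet> w\<bar> \<le> r * \<rho> x w}"
      using real by (auto simp: dual_norm_function_def dual_norm_le_iff is_norm_rho)
    then show ?thesis
      using sets_mem_scaled[of v r] by simp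
  qed simp
qed

section \<open>Integrability over cubes and averaged norms\<close>

lemma bounding_function:
  obtains k where "\<And>Q. Q \<in> cubes n \<Longrightarrow> set_integrable (leb n) Q k"
    "AE x in leb n. \<forall>w\<in>F x. norm w \<le> k x"
proof -
  obtain k where k: "\<forall>x\<in>space (leb n). 0 \<le> k x" "loc_integrable n k"
    "AE x in leb n. F x \<subseteq> (\<lambda>w. k x *\<^sub>R w) ` ball 0 1"
    using F_bounded unfolding loc_integrably_bounded_def by blast
  have "AE x in leb n. \<forall>w\<in>F x. norm w \<le> k x"
    using k(3)
  proof (rule AE_mp, intro AE_I2 impI ballI)
    fix x w
    assume "x \<in> space (leb n)" "F x \<subseteq> (\<lambda>w. k x *\<^sub>R w) ` ball 0 1" "w \<in> F x"
    then have "w \<in> (\<lambda>w. k x *\<^sub>R w) ` ball 0 1" and "k x \<ge> 0"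
      using k(1) by blast+
    then obtain u where "u \<in> ball 0 1" "w = k x *\<^sub>R u"
      by blast
    with \<open>k x \<ge> 0\<close> show "norm w \<le> k x"
      using mult_left_mono[of "norm u" 1 "k x"] by simp
  qed
  moreover have "set_integrable (leb n) Q k" if "Q \<in> cubes n" for Q
    using k(2) compactin_cube[OF that] unfolding loc_integrable_def by blast
  ultimately show ?thesis
    using that by blast
qed

lemma set_integrable_rho:
  assumes Q: "Q \<in> cubes n"
  shows "set_integrable (leb n) Q (\<lambda>x. \<rho> x v)"
proof -
  note [measurable] = cube_sets[OF Q]
  obtain k where "\<And>Q. Q \<in> cubes n \<Longrightarrow> set_integrable (leb n) Q k"
    and k: "AE x in leb n. \<forall>w\<in>F x. norm w \<le> k x"
    using bounding_function by blast
  note k = this(1)[OF Q] this(2)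
  have "set_integrable (leb n) Q (\<lambda>x. norm v * k x)"
    using k(1) by simp
  then show ?thesis
  proof (rule set_integrable_bound)
    show "set_borel_measurable (leb n) Q (\<lambda>x. \<rho> x v)"
      unfolding set_borel_measurable_def by measurable
    show "AE x in leb n. x \<in> Q \<longrightarrow> norm (\<rho> x v) \<le> norm (norm v * k x)"
      using k(2)
    proof (rule AE_mp, intro AE_I2 impI)
      fix x
      assume x: "x \<in> space (leb n)" and kx: "\<forall>w\<in>F x. norm w \<le> k x"
      \<comment> \<open>The sign of \<open>k\<close> is recovered from the bound at the point 0 of
        \<open>F x\<close>.\<close>
      have "k x \<ge> 0"
        using kx K_abcs_zero[OF F_abcs[OF x]] by force
      have "\<rho> x v \<le> norm v * k x"
      proof (rule minkowski_functional_polar_least)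
        fix w assume "w \<in> F x"
        then show "\<bar>v \<bullet> w\<bar> \<le> norm v * k x"
          using kx Cauchy_Schwarz_ineq2[of v w] mult_left_mono[of "norm w" "k x" "norm v"] by force
      qed (simp add: \<open>k x \<ge> 0\<close>)
      then show "norm (\<rho> x v) \<le> norm (norm v * k x)"
        using rho_nonneg[OF x, of v] by simp
    qed
  qed
qed

lemma norm_average_rho:
  assumes Q: "Q \<in> cubes n"
  shows "norm_average n Q \<rho> v = ennreal (avg Q v)"
proof -
  have "(\<integral>\<^sup>+x\<in>Q. ennreal (\<rho> x v) \<partial>leb n) = (\<integral>\<^sup>+x. ennreal (indicator Q x *\<^sub>R \<rho> x v) \<partial>leb n)"
    by (intro nn_integral_cong) (auto simp: indicator_def)
  also have "\<dots> = ennreal (set_lebesgue_integral (leb n) Q (\<lambda>x. \<rho> x v))"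
    unfolding set_lebesgue_integral_def
    using set_integrable_rho[OF Q, of v] rho_nonneg
    by (intro nn_integral_eq_integral) (auto simp: set_integrable_def intro!: AE_I2)
  finally show ?thesis
    using measure_cube_pos[OF Q] rho_nonneg
    by (simp add: norm_average_def avg_def emeasure_eq_measure_cube[OF Q] divide_ennreal
        set_lebesgue_integral_def Bochner_Integration.integral_nonneg)
qed

lemma avg_nonneg:
  assumes Q: "Q \<in> cubes n"
  shows "0 \<le> avg Q v"
  unfolding avg_def set_lebesgue_integral_def using rho_nonneg
  by (auto intro!: divide_nonneg_nonneg Bochner_Integration.integral_nonneg)

text \<open>The pointwise norm properties integrate. For definiteness, a zero average makes
  \<open>\<rho> x v\<close> vanish almost everywhere on \<open>Q\<close>; with
  \<open>v \<noteq> 0\<close> this would make the cube a null set.\<close>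

lemma is_norm_avg:
  assumes Q: "Q \<in> cubes n"
  shows "is_norm (avg Q)"
proof -
  note int = set_integrable_rho[OF Q]
  note [measurable] = cube_sets[OF Q]
  have scale: "avg Q (c *\<^sub>R v) = \<bar>c\<bar> * avg Q v" for c v
  proof -
    have "set_lebesgue_integral (leb n) Q (\<lambda>x. \<rho> x (c *\<^sub>R v))
        = set_lebesgue_integral (leb n) Q (\<lambda>x. \<bar>c\<bar> * \<rho> x v)"
      unfolding set_lebesgue_integral_def
      using is_norm_rho by (intro Bochner_Integration.integral_cong) (auto simp: is_norm_def)
    then show ?thesis
      by (simp add: avg_def)
  qed
  have "v = 0" if "avg Q v = 0" for v
  proof (rule ccontr)
    assume "v \<noteq> 0"
    have "(\<integral>x. indicator Q x *\<^sub>R \<rho> x v \<partial>leb n) = 0"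
      using that measure_cube_pos[OF Q] by (simp add: avg_def set_lebesgue_integral_def)
    then have "AE x in leb n. indicator Q x *\<^sub>R \<rho> x v = 0"
      using int[of v] rho_nonneg
      by (subst (asm) integral_nonneg_eq_0_iff_AE) (auto simp: set_integrable_def intro!: AE_I2)
    then have "AE x in leb n. x \<notin> Q"
    proof (rule AE_mp, intro AE_I2 impI)
      fix x assume "x \<in> space (leb n)" "indicator Q x *\<^sub>R \<rho> x v = 0"
      then show "x \<notin> Q"
        using is_norm_rho[of x] \<open>v \<noteq> 0\<close> by (auto simp: is_norm_def)
    qed
    then have "emeasure (leb n) Q = 0"
      using AE_iff_measurable[OF cube_sets[OF Q], of "\<lambda>x. x \<notin> Q"] sets.sets_into_space[OF cube_sets[OF Q]]
      by auto
    then show False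
      using measure_cube_pos[OF Q] by (simp add: measure_def)
  qed
  moreover have "avg Q 0 = 0"
    using scale[of 0 0] by simp
  moreover have "avg Q (v + w) \<le> avg Q v + avg Q w" for v w
  proof -
    have "set_lebesgue_integral (leb n) Q (\<lambda>x. \<rho> x (v + w))
        \<le> set_lebesgue_integral (leb n) Q (\<lambda>x. \<rho> x v + \<rho> x w)"
    proof (rule set_integral_mono[OF int set_integral_add(1)[OF int int]])
      fix x assume "x \<in> Q"
      then have "x \<in> space (leb n)"
        using sets.sets_into_space[OF cube_sets[OF Q]] by blast
      then show "\<rho> x (v + w) \<le> \<rho> x v + \<rho> x w"
        using is_norm_rho unfolding is_norm_def by blast
    qed
    also have "\<dots> = set_lebesgue_integral (leb n) Q (\<lambda>x. \<rho> x v)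
        + set_lebesgue_integral (leb n) Q (\<lambda>x. \<rho> x w)"
      by (rule set_integral_add(2)[OF int int])
    finally show ?thesis
      using measure_cube_pos[OF Q] by (simp add: avg_def divide_right_mono flip: add_divide_distrib)
  qed
  ultimately show ?thesis
    unfolding is_norm_def using scale avg_nonneg[OF Q] by blast
qed

section \<open>Set averages against averaged norms\<close>

text \<open>Any selection satisfies \<open>\<bar>f y \<bullet> w\<bar> \<le> \<rho> y w\<close>
  almost everywhere on \<open>Q\<close>; integrating gives the bound for its average.\<close>

lemma set_average_subset_dual_ball:
  assumes Q: "Q \<in> cubes n" and x: "x \<in> Q"
  shows "set_average n Q F x \<subseteq> dual_ball (avg Q)"
proof
  fix a assume "a \<in> set_average n Q F x"
  then obtain f where f: "set_integrable (leb n) Q f" "AE y in leb n. y \<in> Q \<longrightarrow> f y \<in> F y"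
    and a: "a = (1 / measure (leb n) Q) *\<^sub>R set_lebesgue_integral (leb n) Q f"
    using x by (auto simp: set_average_def aumann_integral_def)
  have "\<bar>a \<bullet> w\<bar> \<le> avg Q w" for w
  proof -
    have int: "integrable (leb n) (\<lambda>y. (indicator Q y *\<^sub>R f y) \<bullet> w)"
      using f(1) unfolding set_integrable_def by (rule integrable_inner_left)
    have "set_lebesgue_integral (leb n) Q f \<bullet> w = (\<integral>y. (indicator Q y *\<^sub>R f y) \<bullet> w \<partial>leb n)"
      unfolding set_lebesgue_integral_def using f(1)
      by (intro integral_inner_left[symmetric]) (simp add: set_integrable_def)
    also have "\<bar>\<dots>\<bar> \<le> (\<integral>y. \<bar>(indicator Q y *\<^sub>R f y) \<bullet> w\<bar> \<partial>leb n)"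
      by (rule integral_abs_bound)
    also have "\<dots> \<le> (\<integral>y. indicator Q y *\<^sub>R \<rho> y w \<partial>leb n)"
    proof (rule integral_mono_AE)
      show "AE y in leb n. \<bar>(indicator Q y *\<^sub>R f y) \<bullet> w\<bar> \<le> indicator Q y *\<^sub>R \<rho> y w"
        using f(2) by (rule AE_mp) (auto simp: indicator_def mem_F_iff intro!: AE_I2)
    qed (use int set_integrable_rho[OF Q, of w] in \<open>auto simp: set_integrable_def\<close>)
    finally show ?thesis
      using measure_cube_pos[OF Q]
      by (simp add: a avg_def set_lebesgue_integral_def abs_mult divide_right_mono)
  qed
  then show "a \<in> dual_ball (avg Q)"
    by (simp add: dual_ball_def)
qed

text \<open>\<open>f y\<close> is the first term of a dense sequence that lies in \<open>F y\<close>
  and almost attains the support function at \<open>w\<close>. Taking the least index makes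
  \<open>f\<close> measurable, and the bounding function makes it integrable.\<close>

lemma approximate_maximal_selection:
  assumes Q: "Q \<in> cubes n" and w: "w \<noteq> 0" and e: "0 < e"
  obtains f where "set_integrable (leb n) Q f" "\<And>y. y \<in> space (leb n) \<Longrightarrow> f y \<in> F y"
    "\<And>y. y \<in> space (leb n) \<Longrightarrow> (1 - e) * \<rho> y w \<le> f y \<bullet> w"
proof -
  obtain d :: "nat \<Rightarrow> 'v" where d: "\<And>X. open X \<Longrightarrow> X \<noteq> {} \<Longrightarrow> \<exists>e\<in>range d. e \<in> X"
    using countable_dense_sequence by blast
  define P where "P = (\<lambda>i y. (\<forall>u. \<bar>d i \<bullet> u\<bar> \<le> 1 * \<rho> y u) \<and> (1 - e) * \<rho> y w \<le> d i \<bullet> w)"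
  define f where "f = (\<lambda>y. d (LEAST i. P i y))"
  have "\<exists>i. P i y" if y: "y \<in> space (leb n)" for y
  proof -
    \<comment> \<open>Since \<open>w \<noteq> 0\<close>, the factor \<open>1 - e\<close> lowers the
      target strictly. The near maximisers thus form an open half-space meeting \<open>F y\<close>,
      and by density one of them is some \<open>d i \<in> F y\<close>.\<close>
    have "\<rho> y w > 0"
      by (rule is_norm_pos[OF is_norm_rho[OF y] w])
    then have "\<not> \<rho> y w \<le> (1 - e) * \<rho> y w"
      using e by simp
    then obtain b where b: "b \<in> F y" "w \<bullet> b > (1 - e) * \<rho> y w"
      unfolding minkowski_functional_polar_le_iff[OF F_abcs[OF y], of w] by force
    have "b \<in> closure (F y \<inter> range d)"
      using dual_ball_subset_closure_dense[OF is_norm_rho[OF y] d] b(1) dual_ball_rho[OF y] by auto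
    moreover have "open {u. w \<bullet> u > (1 - e) * \<rho> y w}"
      by (rule open_halfspace_gt)
    ultimately have "{u. w \<bullet> u > (1 - e) * \<rho> y w} \<inter> (F y \<inter> range d) \<noteq> {}"
      using open_Int_closure_eq_empty b(2) by blast
    then obtain i where "d i \<in> F y" "w \<bullet> d i > (1 - e) * \<rho> y w"
      by blast
    then have "P i y"
      unfolding P_def using mem_F_iff[OF y] inner_commute[of w "d i"] by simp
    then show ?thesis ..
  qed
  then have "P (LEAST i. P i y) y" if "y \<in> space (leb n)" for y
    using that by (metis LeastI)
  then have fF: "f y \<in> F y" and fw: "(1 - e) * \<rho> y w \<le> f y \<bullet> w" if "y \<in> space (leb n)" for y
    using that by (auto simp: f_def P_def mem_F_iff)
  \<comment> \<open>The quantifier over \<open>u\<close> is uncountable;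
    \<open>sets_mem_scaled\<close> with \<open>c = 1\<close> handles it, which is why
    \<open>P\<close> carries the factor 1.\<close>
  have [measurable]: "Measurable.pred (leb n) (\<lambda>y. \<forall>u. \<bar>d i \<bullet> u\<bar> \<le> 1 * \<rho> y u)" for i
    using sets_mem_scaled[of "d i" 1] by (simp add: pred_def)
  have "(\<lambda>y. LEAST i. P i y) \<in> measurable (leb n) (count_space UNIV)"
    unfolding P_def by measurable
  then have [measurable]: "f \<in> borel_measurable (leb n)"
    unfolding f_def by (rule measurable_compose) simp
  note [measurable] = cube_sets[OF Q]
  obtain k where "\<And>Q. Q \<in> cubes n \<Longrightarrow> set_integrable (leb n) Q k"
    and k: "AE x in leb n. \<forall>w\<in>F x. norm w \<le> k x"
    using bounding_function by blast
  note k = this(1)[OF Q] this(2)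
  have "set_integrable (leb n) Q f"
    using k(1)
  proof (rule set_integrable_bound)
    show "set_borel_measurable (leb n) Q f"
      unfolding set_borel_measurable_def by measurable
    show "AE x in leb n. x \<in> Q \<longrightarrow> norm (f x) \<le> norm (k x)"
      using k(2) by (rule AE_mp) (use fF in \<open>force intro!: AE_I2\<close>)
  qed
  then show ?thesis
    using that fF fw by blast
qed

text \<open>The average \<open>a\<close> of an almost maximal selection satisfies
  \<open>(1 - e) * avg Q w \<le> a \<bullet> w\<close>, and \<open>a\<close> lies in
  \<open>C\<close> times \<open>F x\<close>. Letting \<open>e\<close> tend to 0 from the right gives
  the claim.\<close>

lemma avg_le_of_set_average_subset:
  assumes Q: "Q \<in> cubes n" and x: "x \<in> Q" and C: "C > 0"
    and sub: "set_average n Q F x \<subseteq> (\<lambda>w. C *\<^sub>R w) ` F x"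
  shows "avg Q w \<le> C * \<rho> x w"
proof -
  have xs: "x \<in> space (leb n)"
    using x sets.sets_into_space[OF cube_sets[OF Q]] by blast
  show ?thesis
  proof (cases "w = 0")
    case True
    have "avg Q 0 = 0" "\<rho> x 0 = 0"
      using is_norm_avg[OF Q] is_norm_rho[OF xs] unfolding is_norm_def by blast+
    then show ?thesis
      using True by simp
  next
    case False
    have "(1 - e) * avg Q w \<le> C * \<rho> x w" if "e > 0" for e
    proof -
      obtain f where f: "set_integrable (leb n) Q f" "\<And>y. y \<in> space (leb n) \<Longrightarrow> f y \<in> F y"
        "\<And>y. y \<in> space (leb n) \<Longrightarrow> (1 - e) * \<rho> y w \<le> f y \<bullet> w"
        using approximate_maximal_selection[OF Q False \<open>e > 0\<close>] by blast
      define a where "a = (1 / measure (leb n) Q) *\<^sub>R set_lebesgue_integral (leb n) Q f"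
      have "a \<in> set_average n Q F x"
        unfolding set_average_def aumann_integral_def a_def
        using x f(1,2) by (auto intro!: imageI exI[of _ f])
      then have "\<bar>a \<bullet> w\<bar> \<le> C * \<rho> x w"
        using sub mem_scaleR_image_iff[OF F_abcs[OF xs] C] by blast
      have "(1 - e) * set_lebesgue_integral (leb n) Q (\<lambda>y. \<rho> y w)
          = (\<integral>y. indicator Q y *\<^sub>R ((1 - e) * \<rho> y w) \<partial>leb n)"
        by (simp add: set_lebesgue_integral_def flip: integral_mult_right_zero) (simp add: ac_simps)
      also have "\<dots> \<le> (\<integral>y. (indicator Q y *\<^sub>R f y) \<bullet> w \<partial>leb n)"
      proof (rule integral_mono)
        show "integrable (leb n) (\<lambda>y. indicator Q y *\<^sub>R ((1 - e) * \<rho> y w))"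
          using set_integrable_mult_right[OF set_integrable_rho[OF Q, of w], of "1 - e"]
          by (simp add: set_integrable_def)
        show "integrable (leb n) (\<lambda>y. (indicator Q y *\<^sub>R f y) \<bullet> w)"
          using f(1) unfolding set_integrable_def by (rule integrable_inner_left)
      qed (use f(3) in \<open>auto simp: indicator_def\<close>)
      also have "\<dots> = set_lebesgue_integral (leb n) Q f \<bullet> w"
        unfolding set_lebesgue_integral_def using f(1)
        by (intro integral_inner_left) (simp add: set_integrable_def)
      finally have "(1 - e) * avg Q w \<le> a \<bullet> w"
        using measure_cube_pos[OF Q] by (simp add: a_def avg_def divide_right_mono)
      also have "\<dots> \<le> C * \<rho> x w"
        using \<open>\<bar>a \<bullet> w\<bar> \<le> C * \<rho> x w\<close> by simp
      finally show ?thesis .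
    qed
    then have "\<forall>\<^sub>F e in at_right 0. (1 - e) * avg Q w \<le> C * \<rho> x w"
      by (auto simp: eventually_at_right_less intro: eventually_mono[OF eventually_at_right_less])
    moreover have "((\<lambda>e. (1 - e) * avg Q w) \<longlongrightarrow> (1 - 0) * avg Q w) (at_right 0)"
      by (intro tendsto_intros)
    ultimately show ?thesis
      using tendsto_upperbound[of _ "(1 - 0) * avg Q w" "at_right 0"] by fastforce
  qed
qed

section \<open>Comparison of the two conditions\<close>

text \<open>Measurability of the dual norm makes the essential supremum the least almost everywhere
  bound. The exceptional null set may still depend on \<open>Q\<close> and \<open>v\<close>.\<close>

lemma A1_bound_rho_iff:
  "A1_bound n \<rho> C \<longleftrightarrow> (\<forall>Q\<in>cubes n. \<forall>v. AE x in leb n. x \<in> Q \<longrightarrow>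
    dual_norm_function \<rho> x v \<le> ennreal C * dual_norm (\<lambda>w. ennreal (avg Q w)) v)"
proof -
  have "dual_esssup n Q \<rho> v \<le> c \<longleftrightarrow> (AE x in leb n. x \<in> Q \<longrightarrow> dual_norm_function \<rho> x v \<le> c)"
    if Q: "Q \<in> cubes n" for Q v c
  proof -
    let ?R = "restrict_space (leb n) Q" and ?f = "\<lambda>x. dual_norm_function \<rho> x v"
    have "?f \<in> borel_measurable ?R"
      by (intro measurable_restrict_space1 measurable_dual_norm_function)
    then have "esssup ?R ?f \<le> c \<longleftrightarrow> (AE x in ?R. ?f x \<le> c)"
      using esssup_AE[where M = ?R and f = ?f] esssup_I[where M = ?R and f = ?f and c = c] by (auto elim: order_trans)
    also have "\<dots> \<longleftrightarrow> (AE x in leb n. x \<in> Q \<longrightarrow> ?f x \<le> c)"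
      using cube_sets[OF Q] by (intro AE_restrict_space_iff) auto
    finally show ?thesis
      by (simp add: dual_esssup_def)
  qed
  moreover have "norm_average n Q \<rho> = (\<lambda>w. ennreal (avg Q w))" if "Q \<in> cubes n" for Q
    using norm_average_rho[OF that] by blast
  ultimately show ?thesis
    unfolding A1_bound_def by (simp cong: ball_cong)
qed

lemma A1_bound_if_A1K_bound:
  assumes C: "C > 0" and A1K: "A1K_bound n F C"
  shows "A1_bound n \<rho> C"
  unfolding A1_bound_rho_iff
proof (intro ballI allI)
  fix Q v assume Q: "Q \<in> cubes n"
  show "AE x in leb n. x \<in> Q \<longrightarrow>
    dual_norm_function \<rho> x v \<le> ennreal C * dual_norm (\<lambda>w. ennreal (avg Q w)) v"
    using A1K unfolding A1K_bound_def
  proof (rule AE_mp, intro AE_I2 impI)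
    fix x
    assume x: "x \<in> space (leb n)" "x \<in> Q" and sub: "set_maximal n F x \<subseteq> (\<lambda>w. C *\<^sub>R w) ` F x"
    have "set_average n Q F x \<subseteq> (\<Union>Q\<in>cubes n. set_average n Q F x)"
      using Q by blast
    also have "\<dots> \<subseteq> set_maximal n F x"
      unfolding set_maximal_def using hull_subset closure_subset by (rule order_trans)
    also note sub
    finally have le: "avg Q w \<le> C * \<rho> x w" for w
      by (rule avg_le_of_set_average_subset[OF Q x(2) C])
    show "dual_norm_function \<rho> x v \<le> ennreal C * dual_norm (\<lambda>w. ennreal (avg Q w)) v"
      unfolding dual_norm_function_def dual_norm_def
    proof (rule SUP_least)
      fix w :: 'v assume w: "w \<in> - {0}"
      then have pos: "\<rho> x w > 0" "avg Q w > 0"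
        by (auto intro: is_norm_pos is_norm_rho[OF x(1)] is_norm_avg[OF Q])
      \<comment> \<open>Inverting \<open>avg Q w \<le> C * \<rho> x w\<close> turns the comparison
        of the norms into the reverse one for their duals.\<close>
      then have "1 / \<rho> x w \<le> C / avg Q w"
        using le[of w] by (simp add: pos_divide_le_eq pos_le_divide_eq)
      then have "\<bar>v \<bullet> w\<bar> / \<rho> x w \<le> C * (\<bar>v \<bullet> w\<bar> / avg Q w)"
        using mult_left_mono[of "1 / \<rho> x w" "C / avg Q w" "\<bar>v \<bullet> w\<bar>"] by (simp add: ac_simps)
      then have "ennreal \<bar>v \<bullet> w\<bar> / ennreal (\<rho> x w) \<le> ennreal C * (ennreal \<bar>v \<bullet> w\<bar> / ennreal (avg Q w))"
        using pos C by (simp add: divide_ennreal flip: ennreal_mult)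
      also have "\<dots> \<le> ennreal C * (SUP w\<in>- {0}. ennreal \<bar>v \<bullet> w\<bar> / ennreal (avg Q w))"
        using w by (intro mult_left_mono SUP_upper) auto
      finally show "ennreal \<bar>v \<bullet> w\<bar> / ennreal (\<rho> x w)
          \<le> ennreal C * (SUP w\<in>- {0}. ennreal \<bar>v \<bullet> w\<bar> / ennreal (avg Q w))" .
    qed
  qed
qed

text \<open>An integrable selection on \<open>Q\<close>, extended by zero, is one on \<open>Q'\<close>.\<close>

lemma set_average_enlarge:
  assumes Q: "Q \<in> cubes n" and Q': "Q' \<in> cubes n" and sub: "Q \<subseteq> Q'" and x: "x \<in> Q"
    and a: "a \<in> set_average n Q F x"
  shows "(measure (leb n) Q / measure (leb n) Q') *\<^sub>R a \<in> set_average n Q' F x"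
proof -
  obtain f where f: "set_integrable (leb n) Q f" "AE y in leb n. y \<in> Q \<longrightarrow> f y \<in> F y"
    and a: "a = (1 / measure (leb n) Q) *\<^sub>R set_lebesgue_integral (leb n) Q f"
    using a x by (auto simp: set_average_def aumann_integral_def)
  define g where "g = (\<lambda>y. indicator Q y *\<^sub>R f y)"
  have ind: "indicator Q' y *\<^sub>R g y = indicator Q y *\<^sub>R f y" for y
    using sub by (auto simp: g_def indicator_def)
  have "set_integrable (leb n) Q' g"
    using f(1) by (simp add: set_integrable_def ind)
  moreover have "AE y in leb n. y \<in> Q' \<longrightarrow> g y \<in> F y"
    using f(2) by (rule AE_mp) (auto simp: g_def indicator_def K_abcs_zero F_abcs intro!: AE_I2)
  moreover have "set_lebesgue_integral (leb n) Q' g = set_lebesgue_integral (leb n) Q f"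
    by (simp add: set_lebesgue_integral_def ind)
  ultimately have "set_lebesgue_integral (leb n) Q f \<in> aumann_integral n Q' F"
    unfolding aumann_integral_def by force
  then show ?thesis
    using x sub measure_cube_pos[OF Q] by (auto simp: a set_average_def)
qed

text \<open>Outside one null set the inequality holds for all rational cubes containing
  \<open>x\<close> and all \<open>d i\<close>. The set \<open>?CF\<close> is closed, which allows
  two limits: from the \<open>d i\<close> to the full dual ball, then from rational to arbitrary
  cubes.\<close>

lemma A1K_bound_if_A1_bound:
  assumes C: "C > 0" and A1: "A1_bound n \<rho> C"
  shows "A1K_bound n F C"
proof -
  obtain d :: "nat \<Rightarrow> 'v" where d: "\<And>X. open X \<Longrightarrow> X \<noteq> {} \<Longrightarrow> \<exists>e\<in>range d. e \<in> X"
    using countable_dense_sequence by blast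
  obtain R where R: "countable R" "R \<subseteq> cubes n"
    "\<And>Q t. Q \<in> cubes n \<Longrightarrow> t > measure (leb n) Q \<Longrightarrow> \<exists>Q'\<in>R. Q \<subseteq> Q' \<and> measure (leb n) Q' < t"
    using rational_cubes[of n] by blast
  have "AE x in leb n. \<forall>Q\<in>R. \<forall>i. x \<in> Q \<longrightarrow>
      dual_norm_function \<rho> x (d i) \<le> ennreal C * dual_norm (\<lambda>w. ennreal (avg Q w)) (d i)"
    unfolding AE_ball_countable[OF R(1)] AE_all_countable
    using A1 R(2) unfolding A1_bound_rho_iff by blast
  then show ?thesis
    unfolding A1K_bound_def
  proof (rule AE_mp, intro AE_I2 impI)
    fix x
    assume x: "x \<in> space (leb n)"
      and *: "\<forall>Q\<in>R. \<forall>i. x \<in> Q \<longrightarrow>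
        dual_norm_function \<rho> x (d i) \<le> ennreal C * dual_norm (\<lambda>w. ennreal (avg Q w)) (d i)"
    let ?CF = "(\<lambda>w. C *\<^sub>R w) ` F x"
    have closed: "closed ?CF" and convex: "convex ?CF"
      using F_abcs[OF x] by (auto simp: K_abcs_def closed_scaling convex_scaling)
    have zero: "0 \<in> ?CF"
      using K_abcs_zero[OF F_abcs[OF x]] by force
    have rational: "set_average n Q F x \<subseteq> ?CF" if Q: "Q \<in> R" "x \<in> Q" for Q
    proof -
      have Qc: "Q \<in> cubes n"
        using Q(1) R(2) by blast
      \<comment> \<open>On the dual ball the dual of \<open>avg Q\<close> is at most 1, so the dual
        of \<open>\<rho> x\<close> is at most \<open>C\<close>, which is membership in
        \<open>?CF\<close>.\<close>
      have "dual_ball (avg Q) \<inter> range d \<subseteq> ?CF"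
      proof
        fix v assume v: "v \<in> dual_ball (avg Q) \<inter> range d"
        then have "dual_norm (\<lambda>w. ennreal (avg Q w)) v \<le> ennreal 1"
          using dual_norm_le_iff[OF is_norm_avg[OF Qc], of 1 v] by (simp add: dual_ball_def)
        then have "ennreal C * dual_norm (\<lambda>w. ennreal (avg Q w)) v \<le> ennreal C * ennreal 1"
          by (rule mult_left_mono) simp
        moreover have "dual_norm_function \<rho> x v \<le> ennreal C * dual_norm (\<lambda>w. ennreal (avg Q w)) v"
          using * Q v by blast
        ultimately have "dual_norm_function \<rho> x v \<le> ennreal C"
          by simp
        then show "v \<in> ?CF"
          using C dual_norm_le_iff[OF is_norm_rho[OF x], of C v] mem_scaleR_image_iff[OF F_abcs[OF x] C]
          by (simp add: dual_norm_function_def)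
      qed
      then have "closure (dual_ball (avg Q) \<inter> range d) \<subseteq> ?CF"
        using closed by (rule closure_minimal)
      then show ?thesis
        using set_average_subset_dual_ball[OF Qc Q(2)]
          dual_ball_subset_closure_dense[OF is_norm_avg[OF Qc] d] by blast
    qed
    have "set_average n Q F x \<subseteq> ?CF" if Q: "Q \<in> cubes n" for Q
    proof (cases "x \<in> Q")
      case True
      show ?thesis
      proof
        fix a assume a: "a \<in> set_average n Q F x"
        let ?m = "measure (leb n) Q"
        have m: "?m > 0"
          by (rule measure_cube_pos[OF Q])
        \<comment> \<open>Rational cubes shrink in measure to \<open>Q\<close>. Extension by zero
          puts multiples of \<open>a\<close>, with factors tending to 1, into their averages and
          hence into \<open>?CF\<close>.\<close>
        have "\<exists>Q'\<in>R. Q \<subseteq> Q' \<and> measure (leb n) Q' < ?m + inverse (real (Suc i))" for i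
          by (rule R(3)[OF Q]) simp
        then obtain q where q: "\<And>i. q i \<in> R" "\<And>i. Q \<subseteq> q i"
          "\<And>i. measure (leb n) (q i) < ?m + inverse (real (Suc i))"
          by metis
        have lower: "?m \<le> measure (leb n) (q i)" for i
          using q(1,2)[of i] R(2) Q measure_cube_pos[of "q i" n] emeasure_mono[of Q "q i" "leb n"]
          by (auto simp: cube_sets emeasure_eq_measure_cube subset_iff)
        have "(\<lambda>i. measure (leb n) (q i)) \<longlonglongrightarrow> ?m"
        proof (rule tendsto_sandwich[where f = "\<lambda>_. ?m" and h = "\<lambda>i. ?m + inverse (real (Suc i))"])
          show "(\<lambda>i. ?m + inverse (real (Suc i))) \<longlonglongrightarrow> ?m"
            using tendsto_add[OF tendsto_const[of ?m] LIMSEQ_inverse_real_of_nat] by (simp del: of_nat_Suc)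
        qed (use lower q(3) in \<open>auto intro!: always_eventually less_imp_le simp del: of_nat_Suc\<close>)
        then have "(\<lambda>i. (?m / measure (leb n) (q i)) *\<^sub>R a) \<longlonglongrightarrow> (?m / ?m) *\<^sub>R a"
          using m by (intro tendsto_intros) auto
        moreover have "(?m / measure (leb n) (q i)) *\<^sub>R a \<in> ?CF" for i
          using set_average_enlarge[OF Q _ q(2) True a] rational[OF q(1)] q(1,2)[of i] R(2) True by blast
        ultimately show "a \<in> ?CF"
          using closed_sequentially[OF closed] m by fastforce
      qed
    qed (use zero in \<open>simp add: set_average_def\<close>)
    then have "convex hull (\<Union>Q\<in>cubes n. set_average n Q F x) \<subseteq> ?CF"
      using convex by (intro hull_minimal) auto
    then show "set_maximal n F x \<subseteq> ?CF"
      unfolding set_maximal_def using closed by (rule closure_minimal)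
  qed
qed

lemma A1K_bound_iff_A1_bound: "C > 0 \<Longrightarrow> A1K_bound n F C \<longleftrightarrow> A1_bound n \<rho> C"
  using A1_bound_if_A1K_bound A1K_bound_if_A1_bound by blast

lemma in_A1K_iff_in_A1: "in_A1K n F \<longleftrightarrow> in_A1 n \<rho>"
  unfolding in_A1K_def in_A1_def using A1K_bound_iff_A1_bound by blast

text \<open>Both infima run over the same set of positive constants; if it is empty, both are
  infinite.\<close>

lemma A1K_const_eq_A1_const: "A1K_const n F = A1_const n \<rho>"
  unfolding A1K_const_def A1_const_def using A1K_bound_iff_A1_bound by (metis (no_types, lifting))

end

theorem theorem7p3:
  shows "\<exists>c1>0. \<exists>c2>0. \<forall>n\<ge>1. \<forall>F :: (nat \<Rightarrow> real) \<Rightarrow> (real ^ 'd) set.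
    (\<forall>x\<in>space (leb n). F x \<in> K_abcs) \<longrightarrow>
    set_fun_measurable n F \<longrightarrow>
    loc_integrably_bounded n F \<longrightarrow>
    (let \<rho> = (\<lambda>x v. minkowski_functional (polar_set (F x)) v) in
       norm_function n \<rho> \<and>
       (in_A1K n F \<longleftrightarrow> in_A1 n \<rho>) \<and>
       ennreal c1 * A1K_const n F \<le> A1_const n \<rho> \<and>
       A1_const n \<rho> \<le> ennreal c2 * A1K_const n F)"
\<comment> \<open>The two constants coincide, so both factors can be 1, whatever \<open>n\<close>
  and the dimension of the values.\<close>
proof (intro exI[of _ "1 :: real"] conjI allI impI)
  fix n :: nat and F :: "(nat \<Rightarrow> real) \<Rightarrow> (real ^ 'd) set"
  assume "\<forall>x\<in>space (leb n). F x \<in> K_abcs" "set_fun_measurable n F" "loc_integrably_bounded n F"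
  then interpret abcs_map n F
    by unfold_locales auto
  show "let \<rho> = (\<lambda>x v. minkowski_functional (polar_set (F x)) v) in
       norm_function n \<rho> \<and>
       (in_A1K n F \<longleftrightarrow> in_A1 n \<rho>) \<and>
       ennreal 1 * A1K_const n F \<le> A1_const n \<rho> \<and>
       A1_const n \<rho> \<le> ennreal 1 * A1K_const n F"
    unfolding Let_def using norm_function_rho in_A1K_iff_in_A1 A1K_const_eq_A1_const by simp
qed simp_all

end
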